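(* Let $G$ be a nontrivial traceable graph of order $n$. Then $tpc(P_{\alpha}(G))=3$ for every permutation $\alpha$ of $[n]=\{1,\dots,n\}$.
   Context: All graphs are simple, finite and undirected. A graph is traceable if it has a Hamiltonian path; nontrivial means having at least two vertices. For a graph $G$ with $V(G)=\{v_1,\dots,v_n\}$ and a permutation $\alpha$ of $[n]$, let $G'$ be a disjoint copy of $G$ with vertices $u_1,\dots,u_n$, $u_i$ corresponding to $v_i$; the permutation graph $P_\alpha(G)$ is obtained from $G\cup G'$ by adding all edges $v_iu_{\alpha(i)}$, $i\in[n]$. A graph is total-colored if all its vertices and edges are assigned colors. A path in a total-colored graph is a total proper path if (i) any two adjacent edges on the path differ in color, (ii) any two adjacent internal vertices of the path differ in color, and (iii) every internal vertex of the path differs in color from the edges of the path incident with it. A total-colored graph is total-proper connected if any two vertices are joined by a total proper path. For a connected graph $G$, $tpc(G)$ is the smallest number of colors in a total-coloring making $G$ total-proper connected. *)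

theory Defs
  imports "Graph_Theory.Graph_Theory" "HOL-Combinatorics.Permutations"
begin

text \<open>Simple finite undirected graphs are the symmetric loop-free finite digraphs of
  \<^locale>\<open>pair_graph\<close>; the undirected edge joining \<open>u\<close> and \<open>v\<close> is the two-element set \<open>{u, v}\<close>
  underlying the two opposite arcs \<open>(u, v)\<close> and \<open>(v, u)\<close>.\<close>

definition edges :: "'a pair_pre_digraph \<Rightarrow> 'a set set" where
  "edges G = {{u, v} | u v. (u, v) \<in> parcs G}"

definition traceable :: "'a pair_pre_digraph \<Rightarrow> bool" where
  "traceable G \<longleftrightarrow> (\<exists>p. vpath p (with_proj G) \<and> set p = pverts G)"

text \<open>The function \<open>v\<close> is the labelling \<open>v\<^sub>1, \<dots>, v\<^sub>n\<close> of the vertices of \<open>G\<close>. In the disjoint union,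
  \<open>Inl (v i)\<close> is the vertex \<open>v\<^sub>i\<close> of \<open>G\<close> and \<open>Inr (v i)\<close> is its copy \<open>u\<^sub>i\<close> in \<open>G'\<close>.\<close>

definition permutation_graph ::
  "'a pair_pre_digraph \<Rightarrow> (nat \<Rightarrow> 'a) \<Rightarrow> (nat \<Rightarrow> nat) \<Rightarrow> ('a + 'a) pair_pre_digraph" where
  "permutation_graph G v \<alpha> =
     (let M = {(Inl (v i), Inr (v (\<alpha> i))) | i. i \<in> {1..card (pverts G)}}
      in \<lparr> pverts = pverts G <+> pverts G,
           parcs = map_prod Inl Inl ` parcs G \<union> map_prod Inr Inr ` parcs G \<union> M \<union> M\<inverse> \<rparr>)"

text \<open>A total-coloring consists of a vertex coloring \<open>cv\<close> and an edge coloring \<open>ce\<close> with a common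
  set of colors. The path \<open>p\<close> is given by its list of vertices, the internal ones being
  \<open>p ! i\<close> with \<open>0 < i < length p - 1\<close>.\<close>

definition total_proper_path ::
  "'a pair_pre_digraph \<Rightarrow> ('a \<Rightarrow> nat) \<Rightarrow> ('a set \<Rightarrow> nat) \<Rightarrow> 'a list \<Rightarrow> bool" where
  "total_proper_path G cv ce p \<longleftrightarrow>
     vpath p (with_proj G) \<and>
     (\<forall>i. i + 2 < length p \<longrightarrow> ce {p ! i, p ! (i + 1)} \<noteq> ce {p ! (i + 1), p ! (i + 2)}) \<and>
     (\<forall>i. 0 < i \<and> i + 2 < length p \<longrightarrow> cv (p ! i) \<noteq> cv (p ! (i + 1))) \<and>
     (\<forall>i. 0 < i \<and> i + 1 < length p \<longrightarrow>
        cv (p ! i) \<noteq> ce {p ! (i - 1), p ! i} \<and> cv (p ! i) \<noteq> ce {p ! i, p ! (i + 1)})"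

definition total_proper_connected ::
  "'a pair_pre_digraph \<Rightarrow> ('a \<Rightarrow> nat) \<Rightarrow> ('a set \<Rightarrow> nat) \<Rightarrow> bool" where
  "total_proper_connected G cv ce \<longleftrightarrow>
     (\<forall>x \<in> pverts G. \<forall>y \<in> pverts G. x \<noteq> y \<longrightarrow>
        (\<exists>p. total_proper_path G cv ce p \<and> hd p = x \<and> last p = y))"

definition num_colors ::
  "'a pair_pre_digraph \<Rightarrow> ('a \<Rightarrow> nat) \<Rightarrow> ('a set \<Rightarrow> nat) \<Rightarrow> nat" where
  "num_colors G cv ce = card (cv ` pverts G \<union> ce ` edges G)"

text \<open>Meaningful for connected \<open>G\<close> only: otherwise no total-coloring is total-proper connected
  and the value of \<open>LEAST\<close> is unspecified.\<close>

definition tpc :: "'a pair_pre_digraph \<Rightarrow> nat" where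
  "tpc G = (LEAST k. \<exists>cv ce. total_proper_connected G cv ce \<and> num_colors G cv ce = k)"

lemma pair_graph_permutation_graph:
  assumes G: "pair_graph G"
    and v: "bij_betw v {1..card (pverts G)} (pverts G)"
    and \<alpha>: "\<alpha> permutes {1..card (pverts G)}"
  shows "pair_graph (permutation_graph G v \<alpha>)"
proof -
  interpret pair_graph G by (fact G)
  let ?I = "{1..card (pverts G)}"
  define M where "M = (\<lambda>i. (Inl (v i) :: 'a + 'a, Inr (v (\<alpha> i)) :: 'a + 'a)) ` ?I"
  have parcs: "parcs (permutation_graph G v \<alpha>) =
      map_prod Inl Inl ` parcs G \<union> map_prod Inr Inr ` parcs G \<union> M \<union> M\<inverse>"
    and pverts: "pverts (permutation_graph G v \<alpha>) = pverts G <+> pverts G"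
    by (auto simp: permutation_graph_def M_def Let_def)
  have M: "M \<subseteq> Inl ` pverts G \<times> Inr ` pverts G"
    using bij_betwE[OF v] permutes_in_image[OF \<alpha>] by (auto simp: M_def)
  have fin: "finite M" by (simp add: M_def)
  have sym: "(y, x) \<in> parcs G" if "(x, y) \<in> parcs G" for x y
    using pair_sym_arcs that by (auto simp: symmetric_def elim: symE)
  show ?thesis
  proof unfold_locales
    fix e assume e: "e \<in> parcs (permutation_graph G v \<alpha>)"
    then show "fst e \<in> pverts (permutation_graph G v \<alpha>)"
      "snd e \<in> pverts (permutation_graph G v \<alpha>)"
      using M by (auto simp: parcs pverts in_arcsD1 in_arcsD2)
    show "fst e \<noteq> snd e" using e M pair_no_loops by (auto simp: parcs)
  next
    show "finite (pverts (permutation_graph G v \<alpha>))"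
      by (simp add: pverts pair_finite_verts)
    show "finite (parcs (permutation_graph G v \<alpha>))"
      using fin by (simp add: parcs pair_finite_arcs)
    show "symmetric (with_proj (permutation_graph G v \<alpha>))"
      unfolding symmetric_def with_proj_simps parcs
      using sym by (intro symI) (force simp: image_iff)
  qed
qed

end

theory Submission
  imports Defs
begin

text \<open>Let \<open>x\<^sub>0, \<dots>, x\<^sub>n\<^sub>-\<^sub>1\<close> be a Hamiltonian path of \<open>G\<close>, let \<open>y\<^sub>0, \<dots>, y\<^sub>n\<^sub>-\<^sub>1\<close> be its copy, and let
  \<open>y\<^sub>b\<close> be the partner of \<open>x\<^sub>n\<^sub>-\<^sub>1\<close>. Give \<open>x\<^sub>i\<close> the depth \<open>i\<close> and \<open>y\<^sub>j\<close> the depth \<open>n + \<bar>j - b\<bar>\<close>, so that the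
  depths increase by one along \<open>x\<^sub>0, \<dots>, x\<^sub>n\<^sub>-\<^sub>1, y\<^sub>b\<close> and then along both \<open>y\<^sub>b, y\<^sub>b\<^sub>+\<^sub>1, \<dots>\<close> and
  \<open>y\<^sub>b, y\<^sub>b\<^sub>-\<^sub>1, \<dots>\<close>. Read along such an ascending path, the colors of vertices and edges run
  periodically through three values, so ascending paths are total proper. They join all pairs of
  vertices except \<open>y\<^sub>i, y\<^sub>j\<close> with \<open>j < b < i\<close>; for these, start with the edge from \<open>y\<^sub>i\<close> to its
  partner \<open>x\<^sub>k\<close>, colored like an edge ascending to \<open>x\<^sub>k\<close>, and continue on the ascending path from
  \<open>x\<^sub>k\<close> through \<open>y\<^sub>b\<close> to \<open>y\<^sub>j\<close>. The color of the end vertex \<open>y\<^sub>i\<close> plays no role. Conversely, a total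
  proper path between two non-adjacent vertices already shows three colors.\<close>

section \<open>Total proper paths\<close>

definition joined :: "'a pair_pre_digraph \<Rightarrow> ('a \<Rightarrow> nat) \<Rightarrow> ('a set \<Rightarrow> nat) \<Rightarrow> 'a \<Rightarrow> 'a \<Rightarrow> bool" where
  "joined H cv ce u w \<longleftrightarrow> (\<exists>p. total_proper_path H cv ce p \<and> hd p = u \<and> last p = w)"

lemma vwalk_arcs_rev: "set (vwalk_arcs (rev p)) = (set (vwalk_arcs p))\<inverse>"
proof (induction p rule: vwalk_arcs.induct)
  case (3 a b q)
  then show ?case
    using set_vwalk_arcs_snoc[of "rev (b # q)" a] by (auto simp: last_rev)
qed auto

text \<open>Reduces paths to list predicates that behave well under \<open>rev\<close> and
  \<open>Cons\<close>.\<close>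

lemma vpath_iff_successively:
  "vpath p (with_proj H) \<longleftrightarrow>
     p \<noteq> [] \<and> distinct p \<and> set p \<subseteq> pverts H \<and> successively (\<lambda>u w. (u, w) \<in> parcs H) p"
proof -
  have "set (vwalk_arcs p) \<subseteq> parcs H \<longleftrightarrow> successively (\<lambda>u w. (u, w) \<in> parcs H) p"
    by (induction p rule: vwalk_arcs.induct) auto
  then show ?thesis by (auto simp: vpath_def vwalk_def)
qed

lemma total_proper_path_rev:
  assumes "pair_graph H" and "total_proper_path H cv ce p"
  shows "total_proper_path H cv ce (rev p)"
proof -
  interpret pair_graph H by (fact assms(1))
  have sym: "(a, b) \<in> parcs H" if "(b, a) \<in> parcs H" for a b
    using pair_sym_arcs that by (auto simp: symmetric_def elim: symE)
  have p: "vpath p (with_proj H)"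
    and edge: "\<And>i. i + 2 < length p \<Longrightarrow> ce {p ! i, p ! (i + 1)} \<noteq> ce {p ! (i + 1), p ! (i + 2)}"
    and vert: "\<And>i. 0 < i \<Longrightarrow> i + 2 < length p \<Longrightarrow> cv (p ! i) \<noteq> cv (p ! (i + 1))"
    and inc: "\<And>i. 0 < i \<Longrightarrow> i + 1 < length p \<Longrightarrow>
        cv (p ! i) \<noteq> ce {p ! (i - 1), p ! i} \<and> cv (p ! i) \<noteq> ce {p ! i, p ! (i + 1)}"
    using assms(2) unfolding total_proper_path_def by auto
  have "vpath (rev p) (with_proj H)"
    using p by (auto simp: vpath_iff_successively intro: sym elim: successively_mono)
  moreover have "ce {rev p ! i, rev p ! (i + 1)} \<noteq> ce {rev p ! (i + 1), rev p ! (i + 2)}"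
    if "i + 2 < length p" for i
  proof -
    \<comment> \<open>Position \<open>i\<close> of \<open>rev p\<close> is position
      \<open>length p - 1 - i\<close> of \<open>p\<close>; \<open>j\<close> is the least of the
      three mirrored positions. The later choices of \<open>j\<close> come from the same
      reflection.\<close>
    define j where "j = length p - (i + 3)"
    have "rev p ! i = p ! (j + 2)" "rev p ! (i + 1) = p ! (j + 1)" "rev p ! (i + 2) = p ! j"
      "j + 2 < length p"
      using that unfolding j_def by (auto simp: rev_nth intro!: arg_cong[where f = "nth p"])
    with edge[of j] show ?thesis by (simp add: insert_commute)
  qed
  moreover have "cv (rev p ! i) \<noteq> cv (rev p ! (i + 1))" if "0 < i" "i + 2 < length p" for i
  proof -
    define j where "j = length p - (i + 2)"
    have "rev p ! i = p ! (j + 1)" "rev p ! (i + 1) = p ! j" "j + 2 < length p + 1" "0 < j"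
      using that unfolding j_def by (auto simp: rev_nth intro!: arg_cong[where f = "nth p"])
    with vert[of j] that show ?thesis unfolding j_def by fastforce
  qed
  moreover have "cv (rev p ! i) \<noteq> ce {rev p ! (i - 1), rev p ! i} \<and>
      cv (rev p ! i) \<noteq> ce {rev p ! i, rev p ! (i + 1)}" if "0 < i" "i + 1 < length p" for i
  proof -
    define j where "j = length p - (i + 1)"
    have "rev p ! i = p ! j" "rev p ! (i + 1) = p ! (j - 1)" "rev p ! (i - 1) = p ! (j + 1)"
      "j + 1 < length p" "0 < j"
      using that unfolding j_def by (auto simp: rev_nth intro!: arg_cong[where f = "nth p"])
    with inc[of j] show ?thesis by (simp add: insert_commute)
  qed
  ultimately show ?thesis by (simp add: total_proper_path_def)
qed

lemma joined_sym:
  assumes "pair_graph H" and "joined H cv ce u w"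
  shows "joined H cv ce w u"
proof -
  obtain p where p: "total_proper_path H cv ce p" "hd p = u" "last p = w"
    using assms(2) by (auto simp: joined_def)
  then have "p \<noteq> []" by (auto simp: total_proper_path_def vpath_iff_successively)
  then show ?thesis
    using p total_proper_path_rev[OF assms(1) p(1)] unfolding joined_def
    by (intro exI[of _ "rev p"]) (simp add: hd_rev last_rev)
qed

section \<open>The coloring given by a depth function\<close>

text \<open>List the vertices and edges of an ascending path alternately: a vertex of depth
  \<open>k\<close> has place \<open>2 * k\<close>, and colors are places modulo 3. Elements to be
  distinguished are one or two places apart, so their colors differ.\<close>

definition depth_cv :: "('a \<Rightarrow> nat) \<Rightarrow> 'a \<Rightarrow> nat" where
  "depth_cv d u = (2 * d u) mod 3"

text \<open>\<open>Min\<close> and \<open>Max\<close> read the depths off the unordered edge. A step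
  up from depth \<open>k\<close> has place \<open>2 * k + 1\<close>; any other edge gets the color
  of a step up to its lower end, as 2 is congruent to -1 modulo 3.\<close>

definition depth_ce :: "('a \<Rightarrow> nat) \<Rightarrow> 'a set \<Rightarrow> nat" where
  "depth_ce d e = (2 * Min (d ` e) + (if Max (d ` e) = Suc (Min (d ` e)) then 1 else 2)) mod 3"

definition ascend :: "'a pair_pre_digraph \<Rightarrow> ('a \<Rightarrow> nat) \<Rightarrow> 'a \<Rightarrow> 'a \<Rightarrow> bool" where
  "ascend H d u w \<longleftrightarrow> (u, w) \<in> parcs H \<and> d w = Suc (d u)"

lemma depth_ce_ascend: "d w = Suc (d u) \<Longrightarrow> depth_ce d {u, w} = (2 * d u + 1) mod 3"
  by (simp add: depth_ce_def)

lemma depth_ce_jump: "Suc (d u) < d w \<Longrightarrow> depth_ce d {w, u} = (2 * d u + 2) mod 3"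
  by (simp add: depth_ce_def)

lemma mod3_step:
  fixes k :: nat
  shows "Suc (Suc (2 * k)) mod 3 \<noteq> Suc (2 * k) mod 3"
    and "Suc (2 * k) mod 3 \<noteq> Suc (2 * Suc k) mod 3"
    and "(2 * k) mod 3 \<noteq> (2 * Suc k) mod 3"
    and "(2 * k) mod 3 \<noteq> Suc (Suc (2 * k)) mod 3"
    and "(2 * k) mod 3 \<noteq> Suc (2 * k) mod 3"
    and "(2 * Suc k) mod 3 \<noteq> Suc (2 * k) mod 3"
  by presburger+

lemma mod3_shift: "Suc (2 * k) mod 3 = Suc (Suc (2 * Suc k)) mod (3::nat)"
  by presburger

lemma distinct_ascend:
  assumes "successively (ascend H d) q"
  shows "distinct q"
proof -
  have "successively (\<lambda>u w. d u < d w) q"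
    using assms by (rule successively_mono) (auto simp: ascend_def)
  then have "sorted_wrt (\<lambda>u w. d u < d w) q"
    by (subst (asm) successively_conv_sorted_wrt) (auto simp: transp_def)
  then show ?thesis
    by (auto simp: sorted_wrt_iff_nth_less distinct_conv_nth) (metis linorder_neqE_nat less_irrefl)
qed

text \<open>The color of an end vertex is unconstrained, so the depth of \<open>s\<close> is free;
  it suffices that the first edge is colored as if it ascended to \<open>hd q\<close>. This serves
  both ascending paths and paths that begin with a jump.\<close>

lemma total_proper_path_Cons:
  fixes H d
  defines "cv \<equiv> depth_cv d" and "ce \<equiv> depth_ce d"
  assumes q: "q \<noteq> []" "successively (ascend H d) q" "set q \<subseteq> pverts H"
    and s: "s \<in> pverts H" "s \<notin> set q" "(s, hd q) \<in> parcs H"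
    and col: "ce {s, hd q} = (2 * d (hd q) + 2) mod 3"
  shows "total_proper_path H cv ce (s # q)"
proof -
  have step: "d (q ! Suc i) = Suc (d (q ! i))" if "Suc i < length q" for i
    using successively_nth[OF q(2) that] by (simp add: ascend_def)
  have edge: "ce {q ! i, q ! Suc i} = (2 * d (q ! i) + 1) mod 3" if "Suc i < length q" for i
    using depth_ce_ascend[of d, OF step[OF that]] by (simp add: ce_def)
  have first: "ce {s, q ! 0} = (2 * d (q ! 0) + 2) mod 3"
    using col q(1) by (simp add: hd_conv_nth)
  have "successively (\<lambda>u w. (u, w) \<in> parcs H) q"
    using q(2) by (rule successively_mono) (simp add: ascend_def)
  then have "vpath (s # q) (with_proj H)"
    using q s distinct_ascend[OF q(2)]
    by (simp add: vpath_iff_successively successively_Cons)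
  moreover have "ce {(s # q) ! i, (s # q) ! (i + 1)} \<noteq> ce {(s # q) ! (i + 1), (s # q) ! (i + 2)}"
    if "i + 2 < length (s # q)" for i
    using that edge first step by (cases i) (simp_all add: mod3_step del: mult_Suc_right)
  moreover have "cv ((s # q) ! i) \<noteq> cv ((s # q) ! (i + 1))"
    if "0 < i" "i + 2 < length (s # q)" for i
    using that step by (cases i) (simp_all add: cv_def depth_cv_def mod3_step del: mult_Suc_right)
  moreover have "cv ((s # q) ! i) \<noteq> ce {(s # q) ! (i - 1), (s # q) ! i} \<and>
      cv ((s # q) ! i) \<noteq> ce {(s # q) ! i, (s # q) ! (i + 1)}"
    if i: "0 < i" "i + 1 < length (s # q)" for i
  \<comment> \<open>For \<open>i = 1\<close> the vertex is \<open>hd q\<close>, entered by the edge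
    from \<open>s\<close>; later internal vertices lie between two ascending edges.\<close>
  proof (cases "i = 1")
    case True
    then show ?thesis using i first edge[of 0] by (simp add: cv_def depth_cv_def mod3_step)
  next
    case False
    then obtain k where k: "i = Suc (Suc k)" using i(1) by (metis One_nat_def not0_implies_Suc not_gr_zero)
    then show ?thesis
      using i edge[of k] edge[of "Suc k"] step[of k]
      by (simp add: cv_def depth_cv_def mod3_step del: mult_Suc_right)
  qed
  ultimately show ?thesis by (simp add: total_proper_path_def)
qed

text \<open>The last property serves to keep a vertex that does not ascend to \<open>w\<close> off
  the list.\<close>

lemma ascend_list:
  assumes "(ascend H d)\<^sup>*\<^sup>* u w"
  obtains q where "q \<noteq> []" "hd q = u" "last q = w" "successively (ascend H d) q"
    "\<And>z. z \<in> set q \<Longrightarrow> (ascend H d)\<^sup>*\<^sup>* z w"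
  using assms
proof (induction arbitrary: thesis rule: converse_rtranclp_induct)
  case base
  show ?case by (rule base[of "[w]"]) auto
next
  case (step u u')
  obtain q where "q \<noteq> []" "hd q = u'" "last q = w" "successively (ascend H d) q"
    "\<And>z. z \<in> set q \<Longrightarrow> (ascend H d)\<^sup>*\<^sup>* z w"
    using step.IH by blast
  with step.hyps show ?case
    by (intro step.prems[of "u # q"]) (auto simp: successively_Cons intro: converse_rtranclp_into_rtranclp)
qed

lemma joined_ascend:
  assumes "pair_graph H" and "u \<noteq> w" and "(ascend H d)\<^sup>*\<^sup>* u w"
  shows "joined H (depth_cv d) (depth_ce d) u w"
proof -
  interpret pair_graph H by (fact assms(1))
  obtain u' where u': "ascend H d u u'" "(ascend H d)\<^sup>*\<^sup>* u' w"
    using assms(2,3) by (auto elim: converse_rtranclpE)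
  obtain q where q: "q \<noteq> []" "hd q = u'" "last q = w" "successively (ascend H d) q"
    using ascend_list[OF u'(2)] by metis
  have succ: "successively (ascend H d) (u # q)"
    using q u'(1) by (simp add: successively_Cons)
  have "set q \<subseteq> pverts H"
  proof
    fix z assume "z \<in> set q"
    then obtain k where k: "k < length q" "z = (u # q) ! Suc k"
      by (auto simp: in_set_conv_nth)
    then have "ascend H d ((u # q) ! k) z"
      using successively_nth[OF succ, of k] by simp
    then show "z \<in> pverts H" using in_arcsD2 by (auto simp: ascend_def)
  qed
  \<comment> \<open>The first step of the ascending path takes the place of the edge from
    \<open>s\<close>: its color \<open>2 * d u + 1\<close> agrees modulo 3 with
    \<open>2 * d (hd q) + 2\<close>.\<close>
  moreover have "depth_ce d {u, hd q} = (2 * d (hd q) + 2) mod 3"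
    using u'(1) q(2) by (simp add: ascend_def depth_ce_ascend mod3_shift del: mult_Suc_right)
  moreover have "u \<notin> set q" using distinct_ascend[OF succ] by simp
  ultimately have "total_proper_path H (depth_cv d) (depth_ce d) (u # q)"
    using q u'(1) by (intro total_proper_path_Cons) (auto simp: ascend_def in_arcsD1)
  then show ?thesis using q by (auto simp: joined_def)
qed

lemma joined_jump:
  assumes H: "pair_graph H" and "s \<noteq> w" and su: "(s, u) \<in> parcs H" "Suc (d u) < d s"
    and uw: "(ascend H d)\<^sup>*\<^sup>* u w"
  shows "joined H (depth_cv d) (depth_ce d) s w"
proof (cases "(ascend H d)\<^sup>*\<^sup>* s w")
  case True
  with assms show ?thesis by (simp add: joined_ascend)
next
  case False
  interpret pair_graph H by (fact H)
  obtain q where q: "q \<noteq> []" "hd q = u" "last q = w" "successively (ascend H d) q"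
    "\<And>z. z \<in> set q \<Longrightarrow> (ascend H d)\<^sup>*\<^sup>* z w"
    using ascend_list[OF uw] by metis
  have "w \<in> pverts H"
    using su(1) by (cases rule: rtranclp.cases[OF uw]) (auto simp: ascend_def in_arcsD2)
  then have "set q \<subseteq> pverts H"
    using q(5) by (metis (no_types, lifting) ascend_def converse_rtranclpE in_arcsD1 subsetI)
  moreover have "s \<notin> set q" using q(5) False by blast
  ultimately have "total_proper_path H (depth_cv d) (depth_ce d) (s # q)"
    using q su by (intro total_proper_path_Cons) (auto simp: in_arcsD1 depth_ce_jump)
  then show ?thesis using q by (auto simp: joined_def)
qed

section \<open>Two matched paths\<close>

text \<open>The permutation graph seen along a Hamiltonian path: \<open>\<pi>\<close> is the
  matching expressed in path positions instead of vertex labels.\<close>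

lemma two_matched_paths_three_colors:
  fixes H :: "'a pair_pre_digraph" and x y :: "nat \<Rightarrow> 'a"
  assumes H: "pair_graph H" and n: "n > 0"
    and verts: "pverts H = x ` {..<n} \<union> y ` {..<n}"
    and disj: "x ` {..<n} \<inter> y ` {..<n} = {}"
    and inj: "inj_on x {..<n}" "inj_on y {..<n}"
    and path: "\<And>i. Suc i < n \<Longrightarrow> (x i, x (Suc i)) \<in> parcs H"
      "\<And>i. Suc i < n \<Longrightarrow> (y i, y (Suc i)) \<in> parcs H"
    and match: "\<And>i. i < n \<Longrightarrow> (x i, y (\<pi> i)) \<in> parcs H"
    and \<pi>: "bij_betw \<pi> {..<n} {..<n}"
  obtains d where "total_proper_connected H (depth_cv d) (depth_ce d)"
proof -
  interpret pair_graph H by (fact H)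
  have sym: "(u, w) \<in> parcs H" if "(w, u) \<in> parcs H" for u w
    using pair_sym_arcs that by (auto simp: symmetric_def elim: symE)
  define b where "b = \<pi> (n - 1)"
  have b: "b < n" using bij_betwE[OF \<pi>] n by (simp add: b_def)
  \<comment> \<open>with truncated subtraction, \<open>(j - b) + (b - j)\<close> is the distance of \<open>j\<close> and \<open>b\<close>\<close>
  define d where "d z = (if z \<in> x ` {..<n} then the_inv_into {..<n} x z
     else (let j = the_inv_into {..<n} y z in n + (j - b) + (b - j)))" for z
  have dx: "d (x i) = i" if "i < n" for i
    using that inj by (simp add: d_def the_inv_into_f_f)
  have dy: "d (y j) = n + (j - b) + (b - j)" if "j < n" for j
  proof -
    have "y j \<notin> x ` {..<n}" using disj that by blast
    then show ?thesis using that inj by (simp add: d_def the_inv_into_f_f)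
  qed
  let ?A = "(ascend H d)\<^sup>*\<^sup>*"
  have xx_path: "?A (x i) (x j)" if "i \<le> j" "j < n" for i j
    using that
  proof (induction j rule: dec_induct)
    case (step j)
    then have "ascend H d (x j) (x (Suc j))" by (simp add: ascend_def path dx)
    with step show ?case by (auto intro: rtranclp.rtrancl_into_rtrancl)
  qed simp
  have yy_up: "?A (y i) (y j)" if "b \<le> i" "i \<le> j" "j < n" for i j
    using that(2,3)
  proof (induction j rule: dec_induct)
    case (step j)
    then have "ascend H d (y j) (y (Suc j))" using that(1) by (simp add: ascend_def path dy)
    with step show ?case by (auto intro: rtranclp.rtrancl_into_rtrancl)
  qed simp
  have yy_down: "?A (y i) (y j)" if "j \<le> i" "i \<le> b" for i j
    using that
  proof (induction i rule: dec_induct)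
    case (step i)
    then have "ascend H d (y (Suc i)) (y i)" using b by (simp add: ascend_def path sym dy)
    with step show ?case by (auto intro: converse_rtranclp_into_rtranclp)
  qed simp
  \<comment> \<open>The bridge between the two paths, from depth \<open>n - 1\<close> to depth
    \<open>n\<close>.\<close>
  have "ascend H d (x (n - 1)) (y b)"
    using match[of "n - 1"] n b dy[OF b] dx[of "n - 1"] unfolding ascend_def b_def by simp
  then have x_yb: "?A (x i) (y b)" if "i < n" for i
    using rtranclp.rtrancl_into_rtrancl[OF xx_path[of i "n - 1"]] that by simp
  have xy_path: "?A (x i) (y j)" if "i < n" "j < n" for i j
    using x_yb[OF that(1)] yy_up[of b j] yy_down[of j b] that(2)
    by (meson le_cases order_refl rtranclp_trans)
  let ?J = "joined H (depth_cv d) (depth_ce d)"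
  have far: "?J (y i) (y j)" if ij: "j < b" "b < i" "i < n" for i j
  proof -
    have "i \<in> \<pi> ` {..<n}" using bij_betw_imp_surj_on[OF \<pi>] ij(3) by simp
    then obtain k where k: "k < n" "\<pi> k = i" by auto
    \<comment> \<open>The partner of \<open>x (n - 1)\<close> is \<open>y b\<close>, so
      \<open>k < n - 1\<close>, whereas \<open>y i\<close> has depth at least
      \<open>n\<close>.\<close>
    then have "k \<noteq> n - 1" using ij(2) by (auto simp: b_def)
    then have "Suc k < n" using k(1) by simp
    then have jump: "Suc (d (x k)) < d (y i)"
      unfolding dx[OF k(1)] dy[OF ij(3)] by (rule trans_less_add1[OF trans_less_add1])
    have arc: "(y i, x k) \<in> parcs H" using sym[OF match[OF k(1)]] unfolding k(2) .
    have "i \<noteq> j" "j < n" using ij b by auto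
    then have "y i \<noteq> y j" using inj_on_eq_iff[OF inj(2)] ij(3) by blast
    then show ?thesis
      by (rule joined_jump[OF H _ arc jump xy_path[OF k(1) \<open>j < n\<close>]])
  qed
  have "?J u w" if uw: "u \<in> pverts H" "w \<in> pverts H" "u \<noteq> w" for u w
  proof -
    have asc: "?J u w" if "?A u w \<or> ?A w u"
      using that
    proof
      assume "?A w u"
      then show ?thesis by (rule joined_sym[OF H joined_ascend[OF H \<open>u \<noteq> w\<close>[symmetric]]])
    qed (rule joined_ascend[OF H \<open>u \<noteq> w\<close>])
    consider (xx) i j where "i < n" "j < n" "u = x i" "w = x j"
      | (xy) i j where "i < n" "j < n" "u = x i" "w = y j"
      | (yx) i j where "i < n" "j < n" "u = y i" "w = x j"
      | (yy) i j where "i < n" "j < n" "u = y i" "w = y j"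
      using uw verts by auto
    then show ?thesis
    proof cases
      case (xx i j)
      have "?A u w \<or> ?A w u"
        using xx xx_path[of i j] xx_path[of j i] by (cases "i \<le> j") auto
      then show ?thesis by (rule asc)
    next
      case (xy i j)
      then have "?A u w" using xy_path by simp
      then show ?thesis by (intro asc disjI1)
    next
      case (yx i j)
      then have "?A w u" using xy_path by simp
      then show ?thesis by (intro asc disjI2)
    next
      case (yy i j)
      \<comment> \<open>On one side of \<open>b\<close> an ascending path suffices; across
        \<open>b\<close>, \<open>far\<close> applies, reversed in the last case.\<close>
      consider "b \<le> i" "b \<le> j" | "i \<le> b" "j \<le> b" | "j < b" "b < i" | "i < b" "b < j" by linarith
      then show ?thesis
      proof cases
        case 1
        then have "?A u w \<or> ?A w u"
          using yy yy_up[of i j] yy_up[of j i] by (cases "i \<le> j") auto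
        then show ?thesis by (rule asc)
      next
        case 2
        then have "?A u w \<or> ?A w u"
          using yy yy_down[of i j] yy_down[of j i] by (cases "i \<le> j") auto
        then show ?thesis by (rule asc)
      next
        case 3
        then show ?thesis using far[of j i] yy by simp
      next
        case 4
        then have "?J w u" using far[of i j] yy by simp
        then show ?thesis by (rule joined_sym[OF H])
      qed
    qed
  qed
  then show thesis by (intro that[of d]) (simp add: total_proper_connected_def joined_def)
qed

section \<open>Number of colors\<close>

lemma num_colors_ge_3:
  assumes H: "pair_graph H" and con: "total_proper_connected H cv ce"
    and uw: "u \<in> pverts H" "w \<in> pverts H" "u \<noteq> w" "(u, w) \<notin> parcs H"
  shows "3 \<le> num_colors H cv ce"
proof -
  interpret pair_graph H by (fact H)
  obtain p where p: "total_proper_path H cv ce p" "hd p = u" "last p = w"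
    using con uw by (auto simp: total_proper_connected_def)
  then have vp: "p \<noteq> []" "set p \<subseteq> pverts H" "successively (\<lambda>u w. (u, w) \<in> parcs H) p"
    by (auto simp: total_proper_path_def vpath_iff_successively)
  \<comment> \<open>Distinct non-adjacent ends force an internal vertex \<open>c\<close>; it and its
    two path edges carry three colors.\<close>
  obtain a c e q where q: "p = a # c # e # q"
    using vp p(2,3) uw by (cases p; cases "tl p"; cases "tl (tl p)") auto
  have "ce {a, c} \<noteq> ce {c, e}"
    using p(1) q unfolding total_proper_path_def by (auto dest: spec[of _ 0])
  moreover have "cv c \<noteq> ce {a, c} \<and> cv c \<noteq> ce {c, e}"
    using p(1) q unfolding total_proper_path_def by (auto dest: spec[of _ 1])
  ultimately have "card {cv c, ce {a, c}, ce {c, e}} = 3" by auto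
  moreover have "{cv c, ce {a, c}, ce {c, e}} \<subseteq> cv ` pverts H \<union> ce ` edges H"
  proof -
    have "{a, c} \<in> edges H" "{c, e} \<in> edges H" "c \<in> pverts H"
      using vp q by (auto simp: edges_def)
    then show ?thesis by blast
  qed
  moreover have "edges H = (\<lambda>(u, w). {u, w}) ` parcs H"
    by (auto simp: edges_def)
  then have "finite (cv ` pverts H \<union> ce ` edges H)"
    using pair_finite_verts pair_finite_arcs by simp
  ultimately show ?thesis unfolding num_colors_def using card_mono by metis
qed

lemma num_colors_depth_le_3: "num_colors H (depth_cv d) (depth_ce d) \<le> 3"
proof -
  have "depth_cv d ` pverts H \<union> depth_ce d ` edges H \<subseteq> {..<3}"
    by (auto simp: depth_cv_def depth_ce_def)
  from card_mono[OF _ this] show ?thesis by (simp add: num_colors_def)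
qed

theorem theorem4p1:
  fixes G :: "'a pair_pre_digraph" and n :: nat
    and v :: "nat \<Rightarrow> 'a" and \<alpha> :: "nat \<Rightarrow> nat"
  assumes "pair_graph G"
    and "card (pverts G) = n"
    and "n \<ge> 2"
    and "traceable G"
    and "bij_betw v {1..n} (pverts G)"
    and "\<alpha> permutes {1..n}"
  shows "tpc (permutation_graph G v \<alpha>) = 3"
proof -
  let ?H = "permutation_graph G v \<alpha>"
  have H: "pair_graph ?H"
    using pair_graph_permutation_graph assms by blast
  have verts: "pverts ?H = Inl ` pverts G \<union> Inr ` pverts G"
    by (auto simp: permutation_graph_def Let_def)
  have arcs: "(Inl a, Inl c) \<in> parcs ?H" "(Inr a, Inr c) \<in> parcs ?H" if "(a, c) \<in> parcs G" for a c
    using that by (force simp: permutation_graph_def Let_def)+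
  define f where "f = the_inv_into {1..n} v"
  \<comment> \<open>\<open>f\<close> recovers the label of a vertex, so \<open>Inr (m a)\<close> is
    the partner of \<open>Inl a\<close>.\<close>
  define m where "m = v \<circ> \<alpha> \<circ> f"
  have bij_m: "bij_betw m (pverts G) (pverts G)"
    unfolding m_def f_def
    using assms(5) bij_betw_the_inv_into permutes_imp_bij[OF assms(6)] by (blast intro: bij_betw_trans)
  have vf: "f a \<in> {1..n}" "v (f a) = a" if "a \<in> pverts G" for a
    using bij_betwE[OF bij_betw_the_inv_into[OF assms(5)]] that assms(5)
      f_the_inv_into_f_bij_betw[OF assms(5)] by (auto simp: f_def)
  have fv: "f (v i) = i" if "i \<in> {1..n}" for i
    using assms(5) that by (simp add: f_def the_inv_into_f_f bij_betw_def)
  have cross: "(Inl a, Inr c) \<in> parcs ?H \<longleftrightarrow> c = m a" if "a \<in> pverts G" for a c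
    using vf[OF that] fv assms(2) by (auto simp: permutation_graph_def Let_def m_def)
  obtain p where "vpath p (with_proj G)" and set_p: "set p = pverts G"
    using assms(4) by (auto simp: traceable_def)
  then have p: "distinct p" "successively (\<lambda>a c. (a, c) \<in> parcs G) p"
    by (auto simp: vpath_iff_successively)
  have len: "length p = n" using distinct_card[OF p(1)] set_p assms(2) by simp
  have bij_p: "bij_betw (nth p) {..<n} (pverts G)"
    using bij_betw_nth[OF p(1)] len set_p by blast
  \<comment> \<open>\<open>g\<close> is the position on the Hamiltonian path; conjugating
    \<open>m\<close> with it yields the matching of positions.\<close>
  define g where "g = the_inv_into {..<n} (nth p)"
  have bij_g: "bij_betw g (pverts G) {..<n}"
    unfolding g_def by (rule bij_betw_the_inv_into[OF bij_p])
  have g: "p ! g a = a" if "a \<in> pverts G" for a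
    using f_the_inv_into_f_bij_betw[OF bij_p] that by (simp add: g_def)
  have img: "nth p ` {..<n} = pverts G" and inj_p: "inj_on (nth p) {..<n}"
    using bij_p by (auto simp: bij_betw_def)
  obtain d where d: "total_proper_connected ?H (depth_cv d) (depth_ce d)"
  proof (rule two_matched_paths_three_colors[of ?H n "\<lambda>i. Inl (p ! i)" "\<lambda>i. Inr (p ! i)" "g \<circ> (m \<circ> nth p)"])
    show "pverts ?H = (\<lambda>i. Inl (p ! i)) ` {..<n} \<union> (\<lambda>i. Inr (p ! i)) ` {..<n}"
      unfolding verts img[symmetric] by (simp add: image_image)
    show "bij_betw (g \<circ> (m \<circ> nth p)) {..<n} {..<n}"
      using bij_p bij_m bij_g by (blast intro: bij_betw_trans)
    fix i assume i: "i < n"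
    then have "p ! i \<in> pverts G" "m (p ! i) \<in> pverts G"
      using set_p len bij_betwE[OF bij_m] by auto
    then show "(Inl (p ! i), Inr (p ! (g \<circ> (m \<circ> nth p)) i)) \<in> parcs ?H"
      by (simp add: cross g)
  next
    fix i assume "Suc i < n"
    then have "(p ! i, p ! Suc i) \<in> parcs G" using successively_nth[OF p(2)] len by simp
    then show "(Inl (p ! i), Inl (p ! Suc i)) \<in> parcs ?H"
      "(Inr (p ! i), Inr (p ! Suc i)) \<in> parcs ?H"
      by (rule arcs)+
  next
    show "0 < n" using assms(3) by simp
    show "inj_on (\<lambda>i. Inl (p ! i)) {..<n}" "inj_on (\<lambda>i. Inr (p ! i)) {..<n}"
      using inj_p by (simp_all add: inj_on_def)
  qed (use H in auto)
  \<comment> \<open>A vertex has just one partner in the copy, which has at least two vertices;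
    hence a non-adjacent pair \<open>Inl a\<close>, \<open>Inr c\<close>.\<close>
  have "\<exists>a \<in> pverts G. \<exists>c \<in> pverts G. c \<noteq> m a"
  proof -
    have "v 1 \<in> pverts G" "v 2 \<in> pverts G" "v 1 \<noteq> v 2"
      using assms(3) bij_betwE[OF assms(5)] inj_onD[OF bij_betw_imp_inj_on[OF assms(5)], of 1 2]
      by auto
    then show ?thesis by metis
  qed
  then obtain a c where "a \<in> pverts G" "c \<in> pverts G" "c \<noteq> m a" by blast
  then have ge: "3 \<le> num_colors ?H cv ce" if "total_proper_connected ?H cv ce" for cv ce
    using num_colors_ge_3[OF H that, of "Inl a" "Inr c"] cross[of a c] verts by auto
  show ?thesis unfolding tpc_def
  proof (rule Least_equality)
    have "num_colors ?H (depth_cv d) (depth_ce d) = 3"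
      using ge[OF d] num_colors_depth_le_3[of ?H d] by simp
    with d show "\<exists>cv ce. total_proper_connected ?H cv ce \<and> num_colors ?H cv ce = 3" by blast
  qed (use ge in auto)
qed

end
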